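(* For all positive integers $m$ and $n$, the layer-refined antichain polynomial $\mathcal N_{m,n}(u,v)$ is real stable.
   Context: For a positive integer $k$, $[k]=\{1<\cdots<k\}$ is the $k$-element chain, and $[2]\times[m]\times[n]$ carries the componentwise order. For an antichain $A\subseteq[2]\times[m]\times[n]$ (set of pairwise incomparable elements, possibly empty) write $A_1=A\cap(\{1\}\times[m]\times[n])$ and $A_2=A\cap(\{2\}\times[m]\times[n])$. The layer-refined antichain polynomial is $\mathcal N_{m,n}(u,v)=\sum_{A}u^{|A_1|}v^{|A_2|}$, the sum over all antichains $A$ of $[2]\times[m]\times[n]$. A real multivariate polynomial is real stable if it does not vanish whenever all its (complex) variables have positive imaginary parts. *)

theory Defs
  imports Complex_Main "HOL-Library.Poly_Mapping" "HOL-Library.Product_Order"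
begin

text \<open>
  A polynomial in variables of type \<open>'x\<close> with coefficients of type \<open>'a\<close> has type
  \<open>('x \<Rightarrow>\<^sub>0 nat) \<Rightarrow>\<^sub>0 'a\<close>: it maps exponent vectors to coefficients, both finitely supported.
\<close>

definition eval_complex :: "(('x \<Rightarrow>\<^sub>0 nat) \<Rightarrow>\<^sub>0 real) \<Rightarrow> ('x \<Rightarrow> complex) \<Rightarrow> complex" where
  "eval_complex p z =
    (\<Sum>e\<in>Poly_Mapping.keys p. of_real (Poly_Mapping.lookup p e) *
      (\<Prod>x\<in>Poly_Mapping.keys e. z x ^ Poly_Mapping.lookup e x))"

definition real_stable :: "(('x \<Rightarrow>\<^sub>0 nat) \<Rightarrow>\<^sub>0 real) \<Rightarrow> bool" where
  "real_stable p \<longleftrightarrow> (\<forall>z. (\<forall>x. Im (z x) > 0) \<longrightarrow> eval_complex p z \<noteq> 0)"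

definition antichain :: "'a::order set \<Rightarrow> bool" where
  "antichain A \<longleftrightarrow> pairwise (\<lambda>x y. \<not> x \<le> y \<and> \<not> y \<le> x) A"

text \<open>The order on triples is the componentwise one of \<^theory>\<open>HOL-Library.Product_Order\<close>.\<close>

definition grid :: "nat \<Rightarrow> nat \<Rightarrow> (nat \<times> nat \<times> nat) set" where
  "grid m n = {1..2} \<times> {1..m} \<times> {1..n}"

definition layer :: "nat \<Rightarrow> nat \<Rightarrow> nat \<Rightarrow> (nat \<times> nat \<times> nat) set" where
  "layer k m n = {k} \<times> {1..m} \<times> {1..n}"

datatype layer_var = Var_u | Var_v

definition layer_antichain_poly :: "nat \<Rightarrow> nat \<Rightarrow> (layer_var \<Rightarrow>\<^sub>0 nat) \<Rightarrow>\<^sub>0 real" where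
  "layer_antichain_poly m n =
    (\<Sum>A | A \<subseteq> grid m n \<and> antichain A.
      Poly_Mapping.single
        (Poly_Mapping.single Var_u (card (A \<inter> layer 1 m n)) +
         Poly_Mapping.single Var_v (card (A \<inter> layer 2 m n))) 1)"

end

theory Submission
  imports Defs "HOL-Computational_Algebra.Computational_Algebra"
begin

text \<open>
  Reversing the second grid coordinate turns an antichain into a pair \<open>(P, Q)\<close> of strictly
  increasing lattice chains (the layers 2 and 1) which do not cross. Peeling off columns gives a
  transfer recursion for the generating function of such pairs in boxes of heights \<open>q \<le> p\<close>, and it
  is solved by an explicit difference of two products. For \<open>p = q = n\<close> this reads
  \<open>f(u) f(v) - c (f(u) - h(u)) (f(v) - h(v))\<close> with \<open>f(t) = \<Sum>\<^sub>k C(m,k) C(n,k) t^k\<close>,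
  \<open>h(t) = \<Sum>\<^sub>k C(m,k) C(n,k) t^k / (k + 1)\<close>, \<open>f = h + t h'\<close> and \<open>c = (m + 1) (n + 1) / (m n) > 0\<close>.
  The recursion \<open>(n + 1) H\<^sub>n\<^sub>+\<^sub>1 = (n + 2 + m t) H\<^sub>n + (1 - t) t H\<^sub>n'\<close> for \<open>H\<^sub>n = (n + 1) h\<close> shows
  that all roots of \<open>h\<close> are negative reals, so \<open>w(t) = t h'(t) / h(t)\<close> maps the upper half plane
  into itself. A zero of the polynomial would give \<open>(1 + 1 / w(u)) (1 + 1 / w(v)) = c\<close> with both
  factors in the lower half plane, which is impossible since \<open>c\<close> is positive.
\<close>

section \<open>Antichains as pairs of lattice chains\<close>

definition strict_chain :: "(nat \<times> nat) set \<Rightarrow> bool" where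
  "strict_chain P \<longleftrightarrow> (\<forall>x y x' y'. (x, y) \<in> P \<longrightarrow> (x', y') \<in> P \<longrightarrow> (x < x' \<longleftrightarrow> y < y'))"

text \<open>After reversal of the second coordinate, a layer 1 point (x, y) of \<open>Q\<close> lies
  below a layer 2 point (x', y') of \<open>P\<close> exactly when x \<le> x' and y' \<le> y. This is
  the configuration that is excluded here.\<close>

definition dominates :: "(nat \<times> nat) set \<Rightarrow> (nat \<times> nat) set \<Rightarrow> bool" where
  "dominates P Q \<longleftrightarrow> (\<forall>x y x' y'. (x, y) \<in> Q \<longrightarrow> (x', y') \<in> P \<longrightarrow> x \<le> x' \<longrightarrow> y < y')"

text \<open>The two boxes get separate widths and heights because the recursion peels columns off
  one chain at a time, and each peeled point lowers the heights left for the other points.\<close>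

definition chain_pairs ::
  "nat \<Rightarrow> nat \<Rightarrow> nat \<Rightarrow> nat \<Rightarrow> ((nat \<times> nat) set \<times> (nat \<times> nat) set) set" where
  "chain_pairs i j p q = {(P, Q). P \<subseteq> {..<i} \<times> {..<p} \<and> Q \<subseteq> {..<j} \<times> {..<q} \<and>
     strict_chain P \<and> strict_chain Q \<and> dominates P Q}"

definition pair_weight :: "'a::comm_ring_1 \<Rightarrow> 'a \<Rightarrow> (nat \<times> nat) set \<times> (nat \<times> nat) set \<Rightarrow> 'a" where
  "pair_weight u v = (\<lambda>(P, Q). u ^ card P * v ^ card Q)"

lemma finite_chain_pairs [simp]: "finite (chain_pairs i j p q)"
  by (rule finite_subset[of _ "Pow ({..<i} \<times> {..<p}) \<times> Pow ({..<j} \<times> {..<q})"])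
    (auto simp: chain_pairs_def)

section \<open>Peeling off the last column of a chain\<close>

lemma strict_chain_split:
  assumes "strict_chain P" "P \<subseteq> {..<Suc i} \<times> {..<p}" "(i, y) \<in> P"
  shows "P - {(i, y)} \<subseteq> {..<i} \<times> {..<y} \<and> y < p \<and> P = insert (i, y) (P - {(i, y)})"
proof -
  have "x < i \<and> z < y" if "(x, z) \<in> P" "(x, z) \<noteq> (i, y)" for x z
  proof -
    have "x \<le> i" using that assms(2) by auto
    moreover have "x < i \<longleftrightarrow> z < y" "i < x \<longleftrightarrow> y < z"
      using assms(1,3) that(1) unfolding strict_chain_def by blast+
    ultimately show ?thesis using that(2) by (cases "x = i") auto
  qed
  then show ?thesis using assms(2,3) by auto
qed

lemma strict_chain_insert:
  assumes "strict_chain P" "P \<subseteq> {..<i} \<times> {..<y}"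
  shows "strict_chain (insert (i, y) P)"
proof -
  have "x < i \<and> z < y" if "(x, z) \<in> P" for x z using assms(2) that by auto
  then show ?thesis using assms(1) unfolding strict_chain_def
    by (metis insert_iff less_asym less_irrefl prod.inject)
qed

lemma strict_chain_mono: "strict_chain P \<Longrightarrow> R \<subseteq> P \<Longrightarrow> strict_chain R"
  unfolding strict_chain_def by blast

lemma dominates_mono: "dominates P Q \<Longrightarrow> P' \<subseteq> P \<Longrightarrow> Q' \<subseteq> Q \<Longrightarrow> dominates P' Q'"
  unfolding dominates_def by blast

text \<open>Since \<open>i \<le> j\<close>, the new column \<open>j\<close> lies to the right of all
  of \<open>P\<close>, so domination puts no condition on a point there. The rest of
  \<open>Q\<close> must stay strictly below that point, which lowers \<open>q\<close> to
  \<open>y\<close>.\<close>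

lemma chain_pairs_Suc_right:
  assumes "i \<le> j"
  shows "chain_pairs i (Suc j) p q = chain_pairs i j p q \<union>
    (\<Union>y<q. (\<lambda>(P, Q). (P, insert (j, y) Q)) ` chain_pairs i j p y)" (is "?L = ?R")
proof (intro equalityI subrelI)
  fix P Q assume PQ: "(P, Q) \<in> ?L"
  show "(P, Q) \<in> ?R"
  proof (cases "\<exists>y. (j, y) \<in> Q")
    case True
    then obtain y where y: "(j, y) \<in> Q" by blast
    have "strict_chain Q" "Q \<subseteq> {..<Suc j} \<times> {..<q}" using PQ by (simp_all add: chain_pairs_def)
    note Q = strict_chain_split[OF this y]
    have "(P, Q - {(j, y)}) \<in> chain_pairs i j p y"
      using PQ Q strict_chain_mono[of Q "Q - {(j, y)}"] dominates_mono[of P Q P "Q - {(j, y)}"]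
      by (simp add: chain_pairs_def)
    then show ?thesis using Q by (intro UnI2 UN_I[of y] image_eqI[of _ _ "(P, Q - {(j, y)})"])
        simp_all
  next
    case False
    then have "Q \<subseteq> {..<j} \<times> {..<q}" if "Q \<subseteq> {..<Suc j} \<times> {..<q}"
      using that by (fastforce simp: less_Suc_eq)
    then have "(P, Q) \<in> chain_pairs i j p q"
      using PQ by (simp add: chain_pairs_def)
    then show ?thesis ..
  qed
next
  fix P Q assume "(P, Q) \<in> ?R"
  then consider "(P, Q) \<in> chain_pairs i j p q"
    | y R where "y < q" "(P, R) \<in> chain_pairs i j p y" "Q = insert (j, y) R"
    by auto
  then show "(P, Q) \<in> ?L"
  proof cases
    case 1
    then show ?thesis unfolding chain_pairs_def by fastforce
  next
    case 2
    then have R: "P \<subseteq> {..<i} \<times> {..<p}" "R \<subseteq> {..<j} \<times> {..<y}" "strict_chain P" "strict_chain R"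
      "dominates P R" by (auto simp: chain_pairs_def)
    have "strict_chain Q" using strict_chain_insert R 2 by blast
    moreover have "dominates P Q"
      using R(1,5) assms unfolding 2 dominates_def by fastforce
    moreover have "Q \<subseteq> {..<Suc j} \<times> {..<q}" using R(2) 2 by fastforce
    ultimately show ?thesis using R by (simp add: chain_pairs_def)
  qed
qed

text \<open>All columns of \<open>Q\<close> are at most \<open>i\<close>, so a point
  \<open>(i, y)\<close> of \<open>P\<close> dominates \<open>Q\<close> exactly when all of
  \<open>Q\<close> has height below \<open>y\<close>. Hence the bound
  \<open>min y q\<close>.\<close>

lemma chain_pairs_Suc_left:
  "chain_pairs i (Suc i) p q \<union>
    (\<Union>y<p. (\<lambda>(P, Q). (insert (i, y) P, Q)) ` chain_pairs i (Suc i) y (min y q))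
    = chain_pairs (Suc i) (Suc i) p q" (is "?R = ?L")
proof (intro equalityI subrelI)
  fix P Q assume PQ: "(P, Q) \<in> ?L"
  show "(P, Q) \<in> ?R"
  proof (cases "\<exists>y. (i, y) \<in> P")
    case True
    then obtain y where y: "(i, y) \<in> P" by blast
    have "strict_chain P" "P \<subseteq> {..<Suc i} \<times> {..<p}" using PQ by (simp_all add: chain_pairs_def)
    note P = strict_chain_split[OF this y]
    have "Q \<subseteq> {..<Suc i} \<times> {..<min y q}"
      using PQ y unfolding chain_pairs_def dominates_def by fastforce
    then have "(P - {(i, y)}, Q) \<in> chain_pairs i (Suc i) y (min y q)"
      using PQ P strict_chain_mono[of P "P - {(i, y)}"] dominates_mono[of P Q "P - {(i, y)}" Q]
      by (simp add: chain_pairs_def)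
    then show ?thesis using P by (intro UnI2 UN_I[of y] image_eqI[of _ _ "(P - {(i, y)}, Q)"])
        simp_all
  next
    case False
    then have "P \<subseteq> {..<i} \<times> {..<p}" if "P \<subseteq> {..<Suc i} \<times> {..<p}"
      using that by (fastforce simp: less_Suc_eq)
    then have "(P, Q) \<in> chain_pairs i (Suc i) p q"
      using PQ by (simp add: chain_pairs_def)
    then show ?thesis ..
  qed
next
  fix P Q assume "(P, Q) \<in> ?R"
  then consider "(P, Q) \<in> chain_pairs i (Suc i) p q"
    | y R where "y < p" "(R, Q) \<in> chain_pairs i (Suc i) y (min y q)" "P = insert (i, y) R"
    by auto
  then show "(P, Q) \<in> ?L"
  proof cases
    case 1
    then show ?thesis unfolding chain_pairs_def by fastforce
  next
    case 2
    then have R: "R \<subseteq> {..<i} \<times> {..<y}" "Q \<subseteq> {..<Suc i} \<times> {..<min y q}" "strict_chain R"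
      "strict_chain Q" "dominates R Q" by (auto simp: chain_pairs_def)
    have "strict_chain P" using strict_chain_insert R 2 by blast
    moreover have "dominates P Q"
      using R(2,5) unfolding 2 dominates_def by fastforce
    moreover have "P \<subseteq> {..<Suc i} \<times> {..<p}" using R(1) 2 by fastforce
    moreover have "Q \<subseteq> {..<Suc i} \<times> {..<q}" using R(2) by fastforce
    ultimately show ?thesis using R by (simp add: chain_pairs_def)
  qed
qed

section \<open>Transfer recursion for the generating function\<close>

lemma sum_union_images:
  assumes "finite S" "\<And>y. y < (r::nat) \<Longrightarrow> finite (T y)"
    and "\<And>y. y < r \<Longrightarrow> inj_on (f y) (T y)"
    and "\<And>y a. y < r \<Longrightarrow> a \<in> T y \<Longrightarrow> f y a \<notin> S"
    and "\<And>y z a b. y < r \<Longrightarrow> z < r \<Longrightarrow> a \<in> T y \<Longrightarrow> b \<in> T z \<Longrightarrow> f y a = f z b \<Longrightarrow> y = z"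
  shows "sum g (S \<union> (\<Union>y<r. f y ` T y)) = sum g S + (\<Sum>y<r. \<Sum>a\<in>T y. g (f y a))"
proof -
  have "sum g (S \<union> (\<Union>y<r. f y ` T y)) = sum g S + sum g (\<Union>y<r. f y ` T y)"
    using assms(1,2,4) by (intro sum.union_disjoint) auto
  also have "sum g (\<Union>y<r. f y ` T y) = (\<Sum>y<r. sum g (f y ` T y))"
  proof (rule sum.UNION_disjoint)
    show "\<forall>y\<in>{..<r}. \<forall>z\<in>{..<r}. y \<noteq> z \<longrightarrow> f y ` T y \<inter> f z ` T z = {}"
      using assms(5) by blast
  qed (use assms(2) in simp_all)
  also have "\<dots> = (\<Sum>y<r. \<Sum>a\<in>T y. g (f y a))"
    using assms(3) by (intro sum.cong refl) (simp add: sum.reindex)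
  finally show ?thesis .
qed

definition chain_gf :: "nat \<Rightarrow> nat \<Rightarrow> nat \<Rightarrow> nat \<Rightarrow> 'a::comm_ring_1 \<Rightarrow> 'a \<Rightarrow> 'a" where
  "chain_gf i j p q u v = (\<Sum>X\<in>chain_pairs i j p q. pair_weight u v X)"

lemma finite_chain: "P \<subseteq> {..<i} \<times> {..<p::nat} \<Longrightarrow> finite P" for i :: nat
  by (rule finite_subset) auto

text \<open>The inserted point is the only one in column \<open>i\<close>, so it can be read off
  from the enlarged set. This yields both injectivity of the insertion maps and disjointness of
  their images for different heights.\<close>

lemma insert_eq_insert_box:
  assumes "insert (i, y) P = insert (i, z) R" "P \<subseteq> {..<i} \<times> Y" "R \<subseteq> {..<i::nat} \<times> Z"
  shows "y = z \<and> P = R"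
proof -
  have notin: "(i, w) \<notin> P" "(i, w) \<notin> R" for w using assms(2,3) by auto
  then have "y = z" using assms(1) by blast
  then show ?thesis using assms(1) notin insert_ident by metis
qed

lemma chain_gf_Suc_right:
  assumes "i \<le> j"
  shows "chain_gf i (Suc j) p q u v = chain_gf i j p q u v + v * (\<Sum>y<q. chain_gf i j p y u v)"
proof -
  have "chain_gf i (Suc j) p q u v = chain_gf i j p q u v +
      (\<Sum>y<q. \<Sum>X\<in>chain_pairs i j p y. pair_weight u v ((\<lambda>(P, Q). (P, insert (j, y) Q)) X))"
    unfolding chain_gf_def chain_pairs_Suc_right[OF assms]
  proof (rule sum_union_images)
    show "inj_on (\<lambda>(P, Q). (P, insert (j, y) Q)) (chain_pairs i j p y)" for y
      by (rule inj_onI) (auto simp: chain_pairs_def dest!: insert_eq_insert_box)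
    show "y = z" if "X \<in> chain_pairs i j p y" "Y \<in> chain_pairs i j p z"
      "(\<lambda>(P, Q). (P, insert (j, y) Q)) X = (\<lambda>(P, Q). (P, insert (j, z) Q)) Y" for X Y y z
      using that by (auto simp: chain_pairs_def dest!: insert_eq_insert_box)
  qed (simp_all only: finite_chain_pairs, auto simp: chain_pairs_def)
  also have "(\<Sum>y<q. \<Sum>X\<in>chain_pairs i j p y. pair_weight u v ((\<lambda>(P, Q). (P, insert (j, y) Q)) X))
      = v * (\<Sum>y<q. chain_gf i j p y u v)"
    unfolding chain_gf_def sum_distrib_left
  proof (intro sum.cong refl)
    fix y X assume "X \<in> chain_pairs i j p y"
    then obtain P Q where X: "X = (P, Q)" "Q \<subseteq> {..<j} \<times> {..<y}" by (auto simp: chain_pairs_def)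
    then have "(j, y) \<notin> Q" "finite Q" by (auto simp: finite_chain)
    then show "pair_weight u v ((\<lambda>(P, Q). (P, insert (j, y) Q)) X) = v * pair_weight u v X"
      by (simp add: pair_weight_def X)
  qed
  finally show ?thesis .
qed

lemma chain_gf_Suc_left:
  "chain_gf (Suc i) (Suc i) p q u v =
     chain_gf i (Suc i) p q u v + u * (\<Sum>y<p. chain_gf i (Suc i) y (min y q) u v)"
proof -
  have "chain_gf (Suc i) (Suc i) p q u v = chain_gf i (Suc i) p q u v +
      (\<Sum>y<p. \<Sum>X\<in>chain_pairs i (Suc i) y (min y q).
        pair_weight u v ((\<lambda>(P, Q). (insert (i, y) P, Q)) X))"
    unfolding chain_gf_def chain_pairs_Suc_left[symmetric]
  proof (rule sum_union_images)
    show "inj_on (\<lambda>(P, Q). (insert (i, y) P, Q)) (chain_pairs i (Suc i) y (min y q))" for y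
      by (rule inj_onI) (auto simp: chain_pairs_def dest!: insert_eq_insert_box)
    show "y = z" if "X \<in> chain_pairs i (Suc i) y (min y q)" "Y \<in> chain_pairs i (Suc i) z (min z q)"
      "(\<lambda>(P, Q). (insert (i, y) P, Q)) X = (\<lambda>(P, Q). (insert (i, z) P, Q)) Y" for X Y y z
      using that by (auto simp: chain_pairs_def dest!: insert_eq_insert_box)
  qed (simp_all only: finite_chain_pairs, auto simp: chain_pairs_def)
  also have "(\<Sum>y<p. \<Sum>X\<in>chain_pairs i (Suc i) y (min y q).
        pair_weight u v ((\<lambda>(P, Q). (insert (i, y) P, Q)) X))
      = u * (\<Sum>y<p. chain_gf i (Suc i) y (min y q) u v)"
    unfolding chain_gf_def sum_distrib_left
  proof (intro sum.cong refl)
    fix y X assume "X \<in> chain_pairs i (Suc i) y (min y q)"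
    then obtain P Q where X: "X = (P, Q)" "P \<subseteq> {..<i} \<times> {..<y}" by (auto simp: chain_pairs_def)
    then have "(i, y) \<notin> P" "finite P" by (auto simp: finite_chain)
    then show "pair_weight u v ((\<lambda>(P, Q). (insert (i, y) P, Q)) X) = u * pair_weight u v X"
      by (simp add: pair_weight_def X)
  qed
  finally show ?thesis .
qed

lemma chain_gf_0: "chain_gf 0 0 p q u v = 1"
proof -
  have "chain_pairs 0 0 p q = {({}, {})}"
    by (auto simp: chain_pairs_def strict_chain_def dominates_def)
  then show ?thesis by (simp add: chain_gf_def pair_weight_def)
qed

section \<open>Encoding of grid antichains by pairs of chains\<close>

definition grid_embed :: "nat \<Rightarrow> nat \<Rightarrow> nat \<times> nat \<Rightarrow> nat \<times> nat \<times> nat" where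
  "grid_embed n k = (\<lambda>(x, y). (k, Suc x, n - y))"

definition layer_cells :: "nat \<Rightarrow> nat \<Rightarrow> nat \<Rightarrow> (nat \<times> nat \<times> nat) set \<Rightarrow> (nat \<times> nat) set" where
  "layer_cells m n k A = {(x, y) \<in> {..<m} \<times> {..<n}. grid_embed n k (x, y) \<in> A}"

lemma inj_on_grid_embed: "inj_on (grid_embed n k) ({..<m} \<times> {..<n})"
  by (auto simp: inj_on_def grid_embed_def)

lemma grid_embed_layer_cells: "grid_embed n k ` layer_cells m n k A = A \<inter> layer k m n"
proof -
  have "z \<in> grid_embed n k ` layer_cells m n k A" if "z \<in> A" "z \<in> layer k m n" for z
  proof -
    obtain x y where z: "z = (k, x, y)" "1 \<le> x" "x \<le> m" "1 \<le> y" "y \<le> n"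
      using \<open>z \<in> layer k m n\<close> by (auto simp: layer_def)
    then have "z = grid_embed n k (x - 1, n - y)" by (simp add: grid_embed_def)
    moreover have "(x - 1, n - y) \<in> layer_cells m n k A"
      using z that(1) by (auto simp: layer_cells_def grid_embed_def)
    ultimately show ?thesis by blast
  qed
  then show ?thesis by (auto simp: layer_cells_def layer_def grid_embed_def)
qed

text \<open>Inside one layer, incomparability means that one coordinate rises while the other falls,
  hence both rise after the reversal. Across layers a point of layer 2 is never below one of layer
  1, so only one comparison has to be excluded, and that is \<open>dominates\<close>.\<close>

lemma antichain_embed_iff:
  assumes "P \<subseteq> {..<m} \<times> {..<n}" "Q \<subseteq> {..<m} \<times> {..<n}"
  shows "antichain (grid_embed n 2 ` P \<union> grid_embed n 1 ` Q) \<longleftrightarrow>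
    strict_chain P \<and> strict_chain Q \<and> dominates P Q"
proof -
  \<comment> \<open>The bounds by \<open>n\<close> make the truncated subtraction
    \<open>n - y\<close> strictly decreasing in \<open>y\<close>.\<close>
  have embed_le: "grid_embed n k (x, y) \<le> grid_embed n k' (x', y') \<longleftrightarrow> k \<le> k' \<and> x \<le> x' \<and> y' \<le> y"
    if "y < n" "y' < n" for k k' x x' y y'
    using that by (auto simp: grid_embed_def)
  have embed_eq: "grid_embed n k (x, y) = grid_embed n k' (x', y') \<longleftrightarrow> k = k' \<and> x = x' \<and> y = y'"
    if "y < n" "y' < n" for k k' x x' y y'
    using that by (auto simp: grid_embed_def)
  let ?incomparable = "\<lambda>a b. a \<noteq> b \<longrightarrow> \<not> a \<le> b \<and> \<not> b \<le> (a :: nat \<times> nat \<times> nat)"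
  have chain: "(\<forall>a\<in>grid_embed n k ` R. \<forall>b\<in>grid_embed n k ` R. ?incomparable a b) \<longleftrightarrow> strict_chain R"
    if R: "R \<subseteq> {..<m} \<times> {..<n}" for R k
  proof -
    have "?incomparable (grid_embed n k (x, y)) (grid_embed n k (x', y')) \<longleftrightarrow>
        (x < x' \<longleftrightarrow> y < y') \<and> (x' < x \<longleftrightarrow> y' < y)"
      if "(x, y) \<in> R" "(x', y') \<in> R" for x y x' y'
    proof -
      have "y < n" "y' < n" using that R by auto
      then show ?thesis by (simp only: embed_le embed_eq) auto
    qed
    note incomparable_iff = this
    have "(\<forall>a\<in>R. \<forall>b\<in>R. ?incomparable (grid_embed n k a) (grid_embed n k b)) \<longleftrightarrow>
        (\<forall>a\<in>R. \<forall>b\<in>R. (fst a < fst b \<longleftrightarrow> snd a < snd b) \<and> (fst b < fst a \<longleftrightarrow> snd b < snd a))"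
    proof (intro ball_cong refl)
      fix a b assume "a \<in> R" "b \<in> R"
      then show "?incomparable (grid_embed n k a) (grid_embed n k b) \<longleftrightarrow>
          (fst a < fst b \<longleftrightarrow> snd a < snd b) \<and> (fst b < fst a \<longleftrightarrow> snd b < snd a)"
        using incomparable_iff[of "fst a" "snd a" "fst b" "snd b"] by simp
    qed
    also have "\<dots> \<longleftrightarrow> strict_chain R"
      unfolding strict_chain_def Ball_def split_paired_All fst_conv snd_conv by blast
    finally show ?thesis by (simp only: ball_simps)
  qed
  have cross: "(\<forall>a\<in>grid_embed n 2 ` P. \<forall>b\<in>grid_embed n 1 ` Q. ?incomparable a b) \<longleftrightarrow> dominates P Q"
  proof -
    have "?incomparable (grid_embed n 2 (x', y')) (grid_embed n 1 (x, y)) \<longleftrightarrow> (x \<le> x' \<longrightarrow> y < y')"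
      if "(x', y') \<in> P" "(x, y) \<in> Q" for x y x' y'
    proof -
      have "y < n" "y' < n" using that assms by auto
      then show ?thesis by (simp only: embed_le embed_eq) auto
    qed
    note incomparable_iff = this
    have "(\<forall>a\<in>P. \<forall>b\<in>Q. ?incomparable (grid_embed n 2 a) (grid_embed n 1 b)) \<longleftrightarrow>
        (\<forall>a\<in>P. \<forall>b\<in>Q. fst b \<le> fst a \<longrightarrow> snd b < snd a)"
    proof (intro ball_cong refl)
      fix a b assume "a \<in> P" "b \<in> Q"
      then show "?incomparable (grid_embed n 2 a) (grid_embed n 1 b) \<longleftrightarrow>
          (fst b \<le> fst a \<longrightarrow> snd b < snd a)"
        using incomparable_iff[of "fst a" "snd a" "fst b" "snd b"] by simp
    qed
    also have "\<dots> \<longleftrightarrow> dominates P Q"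
      unfolding dominates_def Ball_def split_paired_All fst_conv snd_conv by blast
    finally show ?thesis by (simp only: ball_simps)
  qed
  \<comment> \<open>By symmetry a condition on pairs from a union has to be checked within each part
    and in one direction between the parts.\<close>
  have union: "(\<forall>a\<in>S \<union> T. \<forall>b\<in>S \<union> T. r a b) \<longleftrightarrow> (\<forall>a\<in>S. \<forall>b\<in>S. r a b) \<and>
      (\<forall>a\<in>T. \<forall>b\<in>T. r a b) \<and> (\<forall>a\<in>S. \<forall>b\<in>T. r a b)"
    if "\<And>a b. r a b \<Longrightarrow> r b a" for S T and r :: "nat \<times> nat \<times> nat \<Rightarrow> nat \<times> nat \<times> nat \<Rightarrow> bool"
    using that by blast
  have antichain_iff: "antichain X \<longleftrightarrow> (\<forall>a\<in>X. \<forall>b\<in>X. ?incomparable a b)" for X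
    unfolding antichain_def pairwise_def by (rule refl)
  show ?thesis
    unfolding antichain_iff chain[OF assms(1), of 2, symmetric]
      chain[OF assms(2), of 1, symmetric] cross[symmetric]
    by (rule union[where r = ?incomparable]) metis
qed

lemma layer_cells_embed:
  assumes "P \<subseteq> {..<m} \<times> {..<n}" "k \<noteq> k'"
  shows "layer_cells m n k (grid_embed n k ` P \<union> grid_embed n k' ` Q) = P"
proof -
  have "grid_embed n k z \<notin> grid_embed n k' ` Q" for z
    using assms(2) by (auto simp: grid_embed_def split: prod.splits)
  moreover have "grid_embed n k z \<in> grid_embed n k ` P \<longleftrightarrow> z \<in> P" if "z \<in> {..<m} \<times> {..<n}" for z
    by (rule inj_on_image_mem_iff[OF inj_on_grid_embed that assms(1)])
  ultimately show ?thesis using assms(1) unfolding layer_cells_def by blast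
qed

text \<open>The maps \<open>layer_cells\<close> and \<open>grid_embed\<close> give a bijection that
  preserves the sizes of the layers. Layer 2 becomes the first chain, which is why \<open>v\<close>
  and \<open>u\<close> are swapped on the right.\<close>

lemma sum_antichains_eq_chain_gf:
  "(\<Sum>A | A \<subseteq> grid m n \<and> antichain A. u ^ card (A \<inter> layer 1 m n) * v ^ card (A \<inter> layer 2 m n))
    = chain_gf m m n n v u"
  unfolding chain_gf_def
proof (rule sum.reindex_bij_witness)
  let ?split = "\<lambda>A. (layer_cells m n 2 A, layer_cells m n 1 A)"
  let ?join = "\<lambda>(P, Q). grid_embed n 2 ` P \<union> grid_embed n 1 ` Q"
  fix A assume "A \<in> {A. A \<subseteq> grid m n \<and> antichain A}"
  then have A: "A \<subseteq> grid m n" "antichain A" by auto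
  have "A \<inter> layer 2 m n \<union> A \<inter> layer 1 m n = A"
    using A(1) by (auto simp: grid_def layer_def)
  then show join: "?join (?split A) = A"
    by (simp add: grid_embed_layer_cells)
  have "layer_cells m n k A \<subseteq> {..<m} \<times> {..<n}" for k by (auto simp: layer_cells_def)
  then show "?split A \<in> chain_pairs m m n n"
    using A(2) join antichain_embed_iff[of "layer_cells m n 2 A" m n "layer_cells m n 1 A"]
    by (simp add: chain_pairs_def)
  have "card (A \<inter> layer k m n) = card (layer_cells m n k A)" for k
    unfolding grid_embed_layer_cells[symmetric]
    by (rule card_image, rule inj_on_subset[OF inj_on_grid_embed]) (auto simp: layer_cells_def)
  then show "pair_weight v u (?split A) =
      u ^ card (A \<inter> layer 1 m n) * v ^ card (A \<inter> layer 2 m n)"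
    by (simp add: pair_weight_def)
next
  let ?split = "\<lambda>A. (layer_cells m n 2 A, layer_cells m n 1 A)"
  let ?join = "\<lambda>(P, Q). grid_embed n 2 ` P \<union> grid_embed n 1 ` Q"
  fix X assume X: "X \<in> chain_pairs m m n n"
  obtain P Q where PQ: "X = (P, Q)" by fastforce
  have sub: "P \<subseteq> {..<m} \<times> {..<n}" "Q \<subseteq> {..<m} \<times> {..<n}" using X PQ by (auto simp: chain_pairs_def)
  have "layer_cells m n 2 (?join X) = P" "layer_cells m n 1 (?join X) = Q"
    using layer_cells_embed[OF sub(1), of 2 1 Q] layer_cells_embed[OF sub(2), of 1 2 P]
    by (simp_all add: PQ Un_commute)
  then show "?split (?join X) = X" using PQ by simp
  have "?join X \<subseteq> grid m n"
    using sub unfolding PQ by (fastforce simp: grid_def grid_embed_def)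
  moreover have "antichain (?join X)"
    using X antichain_embed_iff[OF sub] unfolding PQ by (simp add: chain_pairs_def)
  ultimately show "?join X \<in> {A. A \<subseteq> grid m n \<and> antichain A}" by blast
qed

section \<open>The closed form of the generating function\<close>

text \<open>This is the generating function by size of the strict chains in a box of
  \<open>m\<close> columns and \<open>p\<close> rows: a chain of size \<open>k\<close> is a choice
  of \<open>k\<close> columns and \<open>k\<close> rows, matched in increasing order.\<close>

definition binom_gf :: "nat \<Rightarrow> nat \<Rightarrow> 'a::field_char_0 \<Rightarrow> 'a" where
  "binom_gf m p t = (\<Sum>k\<le>m. of_nat ((m choose k) * (p choose k)) * t ^ k)"

text \<open>
  The correction \<open>cross_fst m p u * cross_snd m q v\<close> counts, for \<open>q \<le> p\<close>, the pairs of chains that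
  do cross, by their sizes. The value of \<open>cross_fst m 0\<close> is junk, but it only ever occurs next to
  \<open>cross_snd m 0 v = 0\<close>.
\<close>

definition cross_snd :: "nat \<Rightarrow> nat \<Rightarrow> 'a::field_char_0 \<Rightarrow> 'a" where
  "cross_snd m q t = (\<Sum>k<m. of_nat ((m - 1 choose k) * (Suc q choose (k + 2))) * t ^ Suc k)"

definition cross_fst :: "nat \<Rightarrow> nat \<Rightarrow> 'a::field_char_0 \<Rightarrow> 'a" where
  "cross_fst m p t = (\<Sum>k<m. of_nat ((Suc m choose (k + 2)) * (p - 1 choose k)) * t ^ Suc k)"

text \<open>This counts the chains in a box of \<open>m + 1\<close> columns and \<open>p\<close>
  rows that use the last column. It is the difference of \<open>binom_gf\<close> in its first
  argument and also that of \<open>cross_snd\<close> in its second.\<close>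

definition diff_fst :: "nat \<Rightarrow> nat \<Rightarrow> 'a::field_char_0 \<Rightarrow> 'a" where
  "diff_fst m p t = (\<Sum>k\<le>m. of_nat ((m choose k) * (p choose Suc k)) * t ^ Suc k)"

text \<open>This counts the chains in a box of \<open>m + 1\<close> columns and \<open>q + 1\<close>
  rows that use the top row. It is the difference of \<open>binom_gf\<close> in its second argument
  and also that of \<open>cross_fst\<close> in its first.\<close>

definition diff_snd :: "nat \<Rightarrow> nat \<Rightarrow> 'a::field_char_0 \<Rightarrow> 'a" where
  "diff_snd m q t = (\<Sum>k\<le>m. of_nat ((Suc m choose Suc k) * (q choose k)) * t ^ Suc k)"

section \<open>Pascal-type recurrences for the factors\<close>

lemma binom_gf_Suc_left: "binom_gf (Suc m) p t = binom_gf m p t + diff_fst m p t"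
proof -
  have "binom_gf (Suc m) p t =
      1 + (\<Sum>k\<le>m. of_nat ((Suc m choose Suc k) * (p choose Suc k)) * t ^ Suc k)"
    unfolding binom_gf_def by (subst sum.atMost_Suc_shift) simp
  also have "\<dots> = 1 + (\<Sum>k\<le>m. of_nat ((m choose Suc k) * (p choose Suc k)) * t ^ Suc k)
      + diff_fst m p t"
    by (simp add: diff_fst_def sum.distrib[symmetric] algebra_simps)
  also have "1 + (\<Sum>k\<le>m. of_nat ((m choose Suc k) * (p choose Suc k)) * t ^ Suc k)
      = (\<Sum>k\<le>Suc m. of_nat ((m choose k) * (p choose k)) * t ^ k)"
    by (subst sum.atMost_Suc_shift) simp
  also have "\<dots> = binom_gf m p t" by (simp add: binom_gf_def binomial_eq_0)
  finally show ?thesis .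
qed

lemma diff_fst_Suc_right: "diff_fst m (Suc p) t = diff_fst m p t + t * binom_gf m p t"
  by (simp add: diff_fst_def binom_gf_def sum_distrib_left sum.distrib[symmetric] algebra_simps)

lemma diff_fst_0: "diff_fst m 0 t = 0" by (simp add: diff_fst_def)

lemma cross_snd_0: "cross_snd m 0 t = 0" by (simp add: cross_snd_def binomial_eq_0)

lemma binom_gf_Suc_right: "binom_gf (Suc m) (Suc p) t = binom_gf (Suc m) p t + diff_snd m p t"
proof -
  have "binom_gf (Suc m) q t =
      1 + (\<Sum>k\<le>m. of_nat ((Suc m choose Suc k) * (q choose Suc k)) * t ^ Suc k)" for q
    unfolding binom_gf_def by (subst sum.atMost_Suc_shift) simp
  then show ?thesis by (simp add: diff_snd_def sum.distrib[symmetric] algebra_simps)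
qed

lemma cross_snd_Suc_right:
  "cross_snd (Suc m) (Suc q) t = cross_snd (Suc m) q t + diff_fst m (Suc q) t"
  by (simp add: cross_snd_def diff_fst_def sum.distrib[symmetric] algebra_simps lessThan_Suc_atMost)

lemma diff_snd_Suc_right: "diff_snd m (Suc q) t = diff_snd m q t + t * cross_fst m (Suc q) t"
proof -
  have shift: "(\<Sum>k\<le>m. f k) = f 0 + (\<Sum>k<m. f (Suc k))" for f :: "nat \<Rightarrow> 'a"
    by (cases m) (simp_all add: sum.atMost_Suc_shift lessThan_Suc_atMost
        del: sum.atMost_Suc sum.lessThan_Suc)
  show ?thesis
    unfolding diff_snd_def cross_fst_def shift
    by (simp add: sum_distrib_left sum.distrib[symmetric] algebra_simps)
qed

lemma cross_fst_Suc_left: "cross_fst (Suc m) (Suc p) t = cross_fst m (Suc p) t + diff_snd m p t"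
  by (simp add: cross_fst_def diff_snd_def sum.distrib[symmetric] algebra_simps
      lessThan_Suc_atMost[symmetric] binomial_eq_0)

text \<open>Pascal's rule on the first binomial. For \<open>q = Suc r\<close> the last sum is
  \<open>cross_snd (Suc m) r t\<close>, the form needed for \<open>cross_snd_sum\<close>.\<close>

lemma diff_fst_Suc_left:
  "diff_fst (Suc m) q t = diff_fst m q t
      + t * (\<Sum>k\<le>m. of_nat ((m choose k) * (q choose (k + 2))) * t ^ Suc k)"
proof -
  have "diff_fst (Suc m) q t = of_nat q * t +
      (\<Sum>k\<le>m. of_nat ((Suc m choose Suc k) * (q choose (k + 2))) * t ^ (k + 2))"
    unfolding diff_fst_def by (subst sum.atMost_Suc_shift) simp
  also have "\<dots> = of_nat q * t + (\<Sum>k\<le>m. of_nat ((m choose Suc k) * (q choose (k + 2))) * t ^ (k + 2))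
      + t * (\<Sum>k\<le>m. of_nat ((m choose k) * (q choose (k + 2))) * t ^ Suc k)"
    by (simp add: sum_distrib_left sum.distrib[symmetric] algebra_simps)
  also have "of_nat q * t + (\<Sum>k\<le>m. of_nat ((m choose Suc k) * (q choose (k + 2))) * t ^ (k + 2))
      = (\<Sum>k\<le>Suc m. of_nat ((m choose k) * (q choose Suc k)) * t ^ Suc k)"
    by (subst sum.atMost_Suc_shift) simp
  also have "\<dots> = diff_fst m q t" by (simp add: diff_fst_def binomial_eq_0)
  finally show ?thesis .
qed

text \<open>The correction factor obeys the same column recursion as \<open>binom_gf\<close>, but
  only from one column onwards: \<open>cross_snd 0 q t\<close> is zero, while
  \<open>cross_snd 1 q t\<close> need not be.\<close>

lemma cross_snd_sum:
  "cross_snd (Suc (Suc m)) q t = cross_snd (Suc m) q t + t * (\<Sum>y<q. cross_snd (Suc m) y t)"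
proof (induction q)
  case (Suc q)
  have "diff_fst (Suc m) (Suc q) t = diff_fst m (Suc q) t + t * cross_snd (Suc m) q t"
    by (simp only: diff_fst_Suc_left cross_snd_def lessThan_Suc_atMost diff_Suc_1 add_2_eq_Suc')
  then show ?case using Suc by (simp add: cross_snd_Suc_right algebra_simps)
qed (simp add: cross_snd_0)

lemma diff_fst_sum: "diff_fst m q t = t * (\<Sum>y<q. binom_gf m y t)"
  by (induction q) (simp_all add: diff_fst_0 diff_fst_Suc_right algebra_simps)

text \<open>Absorbing \<open>Suc k\<close> into either binomial shows that corresponding
  coefficients have a ratio independent of \<open>k\<close>, so the two functions of
  \<open>t\<close> are proportional.\<close>

lemma diff_snd_eq_diff_fst:
  "of_nat (Suc q) * diff_snd m q t = of_nat (Suc m) * diff_fst m (Suc q) t"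
proof -
  have "Suc q * ((Suc m choose Suc k) * (q choose k))
      = Suc m * ((m choose k) * (Suc q choose Suc k))" for k
    by (metis Suc_times_binomial_eq mult.assoc mult.commute mult.left_commute)
  then have eq: "of_nat (Suc q) * of_nat ((Suc m choose Suc k) * (q choose k)) =
     (of_nat (Suc m) * of_nat ((m choose k) * (Suc q choose Suc k)) :: 'a)" for k
    by (metis of_nat_mult)
  show ?thesis
    unfolding diff_snd_def diff_fst_def sum_distrib_left
    by (rule sum.cong[OF refl]) (simp only: mult.assoc[symmetric] eq)
qed

text \<open>This symmetry makes the boundary terms on the diagonal \<open>p = q\<close> cancel.\<close>

lemma diff_fst_mult_diff_snd:
  "diff_fst m (Suc q) u * diff_snd m q v = diff_snd m q u * diff_fst m (Suc q) v"
proof -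
  have "of_nat (Suc q) * (diff_fst m (Suc q) u * diff_snd m q v)
      = diff_fst m (Suc q) u * (of_nat (Suc m) * diff_fst m (Suc q) v)"
    unfolding diff_snd_eq_diff_fst[symmetric] by (rule mult.left_commute)
  also have "\<dots> = (of_nat (Suc m) * diff_fst m (Suc q) u) * diff_fst m (Suc q) v"
    by (simp only: mult.assoc mult.left_commute)
  also have "\<dots> = of_nat (Suc q) * (diff_snd m q u * diff_fst m (Suc q) v)"
    unfolding diff_snd_eq_diff_fst[symmetric] by (rule mult.assoc)
  finally show ?thesis by (simp only: mult_left_cancel[OF of_nat_neq_0])
qed

section \<open>Solution of the transfer recursion\<close>

lemma cross_fst_0_left: "cross_fst 0 p t = 0" by (simp add: cross_fst_def)

text \<open>The factor \<open>cross_fst m p u\<close> vanishes for \<open>m = 0\<close>, precisely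
  where the recursion of \<open>cross_snd\<close> breaks down.\<close>

lemma cross_product_sum:
  "cross_fst m p u * cross_snd (Suc m) q v
      = cross_fst m p u * (cross_snd m q v + v * (\<Sum>y<q. cross_snd m y v))"
  by (cases m) (simp_all add: cross_fst_0_left cross_snd_sum)

lemma closed_form_Suc_snd: "binom_gf m p u * binom_gf m q v - cross_fst m p u * cross_snd m q v
     + v * (\<Sum>y<q. binom_gf m p u * binom_gf m y v - cross_fst m p u * cross_snd m y v)
   = binom_gf m p u * binom_gf (Suc m) q v - cross_fst m p u * cross_snd (Suc m) q v"
  unfolding cross_product_sum binom_gf_Suc_left diff_fst_sum sum_subtractf
      sum_distrib_left[symmetric]
  by (simp add: algebra_simps)

text \<open>Here both boxes have the same height \<open>y\<close>, so a step of the induction on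
  \<open>q\<close> raises the height in the \<open>u\<close> factors and in the \<open>v\<close>
  factors at once.\<close>

lemma closed_form_sum_diagonal:
  "u * (\<Sum>y<q. binom_gf m y u * binom_gf (Suc m) y v - cross_fst m y u * cross_snd (Suc m) y v)
   = diff_fst m q u * binom_gf (Suc m) q v
      - (cross_fst (Suc m) q u - cross_fst m q u) * cross_snd (Suc m) q v"
proof (induction q)
  case (Suc q)
  \<comment> \<open>For positive \<open>q\<close> the first factors agree; for \<open>q = 0\<close>
    they involve the junk value of \<open>cross_fst\<close>, which
    \<open>cross_snd (Suc m) 0 v = 0\<close> removes.\<close>
  have B: "(diff_snd m q u - u * cross_fst m q u) * cross_snd (Suc m) q v
      = (cross_fst (Suc m) q u - cross_fst m q u) * cross_snd (Suc m) q v"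
    by (cases q) (simp_all add: cross_snd_0 cross_fst_Suc_left diff_snd_Suc_right)
  have "u * (\<Sum>y<Suc q. binom_gf m y u * binom_gf (Suc m) y v
      - cross_fst m y u * cross_snd (Suc m) y v)
     = diff_fst m q u * binom_gf (Suc m) q v
      - (diff_snd m q u - u * cross_fst m q u) * cross_snd (Suc m) q v
       + u * (binom_gf m q u * binom_gf (Suc m) q v - cross_fst m q u * cross_snd (Suc m) q v)"
    using Suc unfolding B by (simp add: algebra_simps)
  also have "\<dots> = diff_fst m (Suc q) u * binom_gf (Suc m) q v
      - diff_snd m q u * cross_snd (Suc m) q v"
    by (simp add: diff_fst_Suc_right algebra_simps)
  \<comment> \<open>Raising the height in the \<open>v\<close> factors adds
    \<open>diff_fst m (Suc q) u * diff_snd m q v\<close> and subtracts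
    \<open>diff_snd m q u * diff_fst m (Suc q) v\<close>, which are equal.\<close>
  also have "\<dots> = diff_fst m (Suc q) u * binom_gf (Suc m) (Suc q) v
      - diff_snd m q u * cross_snd (Suc m) (Suc q) v"
    unfolding binom_gf_Suc_right cross_snd_Suc_right distrib_left diff_fst_mult_diff_snd by simp
  finally show ?case by (simp add: cross_fst_Suc_left)
qed (simp add: diff_fst_0 cross_snd_0)

text \<open>Up to height \<open>q\<close> the sum is the diagonal one. Beyond it
  \<open>min y q = q\<close>, so the \<open>v\<close> factors stay fixed and only the
  \<open>u\<close> factors telescope.\<close>

lemma closed_form_sum_fst:
  assumes "q \<le> p"
  shows "u * (\<Sum>y<p. binom_gf m y u * binom_gf (Suc m) (min y q) v
      - cross_fst m y u * cross_snd (Suc m) (min y q) v)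
   = diff_fst m p u * binom_gf (Suc m) q v
      - (cross_fst (Suc m) p u - cross_fst m p u) * cross_snd (Suc m) q v"
  using assms
proof (induction p rule: dec_induct)
  case base
  show ?case by (simp add: min_absorb1 closed_form_sum_diagonal)
next
  case (step p)
  have B: "(diff_snd m p u - u * cross_fst m p u) * cross_snd (Suc m) q v
      = (cross_fst (Suc m) p u - cross_fst m p u) * cross_snd (Suc m) q v"
    using step.hyps by (cases p) (simp_all add: cross_snd_0 cross_fst_Suc_left diff_snd_Suc_right)
  have "u * (\<Sum>y<Suc p. binom_gf m y u * binom_gf (Suc m) (min y q) v
      - cross_fst m y u * cross_snd (Suc m) (min y q) v)
     = (diff_fst m p u * binom_gf (Suc m) q v
      - (diff_snd m p u - u * cross_fst m p u) * cross_snd (Suc m) q v)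
       + u * (binom_gf m p u * binom_gf (Suc m) q v - cross_fst m p u * cross_snd (Suc m) q v)"
    unfolding sum.lessThan_Suc distrib_left step.IH B using step.hyps by (simp add: min_absorb2)
  also have "\<dots> = diff_fst m (Suc p) u * binom_gf (Suc m) q v
      - diff_snd m p u * cross_snd (Suc m) q v"
    by (simp add: diff_fst_Suc_right algebra_simps)
  finally show ?case by (simp add: cross_fst_Suc_left)
qed

lemma chain_gf_eq:
  fixes u v :: "'a::field_char_0"
  assumes "q \<le> p"
  shows "chain_gf m m p q u v = binom_gf m p u * binom_gf m q v - cross_fst m p u * cross_snd m q v"
  using assms
proof (induction m arbitrary: p q)
  case 0
  then show ?case by (simp add: chain_gf_0 binom_gf_def cross_fst_def)
next
  case (Suc m)
  \<comment> \<open>The intermediate stage, where only the second chain has received its new column,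
    advances just the \<open>v\<close> factors.\<close>
  have half: "chain_gf m (Suc m) p q u v
      = binom_gf m p u * binom_gf (Suc m) q v - cross_fst m p u * cross_snd (Suc m) q v"
    if "q \<le> p" for p q
    using that by (simp add: chain_gf_Suc_right Suc.IH closed_form_Suc_snd[symmetric])
  have "u * (\<Sum>y<p. chain_gf m (Suc m) y (min y q) u v)
      = diff_fst m p u * binom_gf (Suc m) q v
      - (cross_fst (Suc m) p u - cross_fst m p u) * cross_snd (Suc m) q v"
    by (simp add: half closed_form_sum_fst[OF Suc.prems])
  then show ?case
    by (simp add: chain_gf_Suc_left half[OF Suc.prems] binom_gf_Suc_left algebra_simps)
qed

section \<open>A Jacobi-type polynomial with negative roots\<close>

lemma of_nat_binomial_Suc_right:
  "(1 + of_nat k) * of_nat (n choose Suc k) =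
    ((of_nat n - of_nat k) * of_nat (n choose k) :: 'a::comm_ring_1)"
proof (cases "k \<le> n")
  case True
  have "Suc k * (n choose Suc k) = (n - k) * (n choose k)"
    by (metis binomial_absorb_comp binomial_absorption)
  then have "(of_nat (Suc k * (n choose Suc k)) :: 'a) = of_nat ((n - k) * (n choose k))"
    by simp
  then show ?thesis using True by (simp add: of_nat_diff algebra_simps)
qed (simp add: binomial_eq_0)

text \<open>This is \<open>n + 1\<close> times the hypergeometric polynomial 2F1(-m, -n; 2; x), a
  Jacobi polynomial up to a change of variable.\<close>

definition jacobi_poly :: "nat \<Rightarrow> nat \<Rightarrow> complex poly" where
  "jacobi_poly m n = (\<Sum>k\<le>m. monom (of_nat ((m choose k) * (Suc n choose Suc k))) k)"

lemma coeff_jacobi_poly [simp]: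
  "coeff (jacobi_poly m n) k = of_nat ((m choose k) * (Suc n choose Suc k))"
  by (simp add: jacobi_poly_def coeff_sum binomial_eq_0)

lemma jacobi_poly_rec:
  "smult (of_nat (Suc n)) (jacobi_poly m (Suc n)) =
     [:of_nat (n + 2), of_nat m:] * jacobi_poly m n
       + [:1, -1:] * ([:0, 1:] * pderiv (jacobi_poly m n))"
proof (rule poly_eqI)
  fix k
  let ?c = "\<lambda>a b. of_nat (a choose b) :: complex"
  have pascal: "?c (Suc (Suc n)) (Suc k) = ?c (Suc n) k + ?c (Suc n) (Suc k)"
    by (simp only: binomial_Suc_Suc of_nat_add)
  have n_rec: "(1 + of_nat k) * ?c (Suc n) (Suc k) = (of_nat (Suc n) - of_nat k) * ?c (Suc n) k"
    by (rule of_nat_binomial_Suc_right)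
  show "coeff (smult (of_nat (Suc n)) (jacobi_poly m (Suc n))) k =
    coeff ([:of_nat (n + 2), of_nat m:] * jacobi_poly m n
       + [:1, -1:] * ([:0, 1:] * pderiv (jacobi_poly m n))) k"
  proof (cases k)
    case 0
    then show ?thesis by (simp add: algebra_simps)
  next
    case (Suc j)
    have m_rec: "(1 + of_nat j) * ?c m (Suc j) = (of_nat m - of_nat j) * ?c m j"
      by (rule of_nat_binomial_Suc_right)
    have coeff_rhs: "coeff ([:of_nat (n + 2), of_nat m:] * jacobi_poly m n
       + [:1, -1:] * ([:0, 1:] * pderiv (jacobi_poly m n))) k =
       of_nat (n + 2) * (?c m (Suc j) * ?c (Suc n) (Suc k)) + of_nat m * (?c m j * ?c (Suc n) k)
       + of_nat (Suc j) * (?c m (Suc j) * ?c (Suc n) (Suc k)) - of_nat j * (?c m j * ?c (Suc n) k)"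
      unfolding Suc by (cases j) (simp_all add: coeff_pderiv del: binomial_Suc_Suc of_nat_Suc)
    also have "\<dots> = (of_nat n + 3 + of_nat j) * ?c m (Suc j) * ?c (Suc n) (Suc k)
       + ((of_nat m - of_nat j) * ?c m j) * ?c (Suc n) k"
      by (simp add: algebra_simps del: binomial_Suc_Suc)
    \<comment> \<open>With \<open>k = j + 1\<close>, \<open>m_rec\<close> makes
      \<open>?c m (Suc j)\<close> a common factor, and n + 3 + j is split as (n + 1) + (1 + k) so
      that \<open>n_rec\<close> applies to the second part.\<close>
    also have "\<dots> = ?c m (Suc j) * ((of_nat n + 1) * ?c (Suc n) (Suc k)
       + (1 + of_nat k) * ?c (Suc n) (Suc k) + of_nat k * ?c (Suc n) k)"
      unfolding m_rec[symmetric] Suc by (simp add: algebra_simps del: binomial_Suc_Suc)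
    also have "\<dots> = of_nat (Suc n) * (?c m (Suc j) * ?c (Suc (Suc n)) (Suc k))"
      unfolding n_rec pascal by (simp add: algebra_simps del: binomial_Suc_Suc)
    finally show ?thesis
      unfolding coeff_rhs by (simp add: Suc del: binomial_Suc_Suc)
  qed
qed

section \<open>Logarithmic derivatives on the upper half plane\<close>

lemma Im_divide_add_of_real:
  assumes "Im z > 0" "r > 0"
  shows "Im (z / (z + complex_of_real r)) > 0"
proof -
  let ?w = "z + complex_of_real r"
  have w: "(Re z + r)\<^sup>2 + (Im z)\<^sup>2 > 0"
    using assms by (simp add: add_nonneg_pos)
  have "Im (z / ?w) = r * Im z / ((Re z + r)\<^sup>2 + (Im z)\<^sup>2)"
    by (simp add: Im_divide algebra_simps)
  then show ?thesis using assms w by simp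
qed

text \<open>Splitting off roots one by one writes z p'(z) / p(z) as the sum of z / (z - a) over the
  roots a, and each term lies in the upper half plane. The weak bound covers constant polynomials,
  which occur in the induction for the roots; the strict one is for the final argument.\<close>

lemma Im_log_derivative_ge:
  fixes p :: "complex poly"
  assumes "p \<noteq> 0"
    and "\<And>w. poly p w = 0 \<Longrightarrow> Im w = 0 \<and> Re w < 0"
    and "Im z > 0"
  shows "Im (z * poly (pderiv p) z / poly p z) \<ge> 0 \<and>
    (degree p > 0 \<longrightarrow> Im (z * poly (pderiv p) z / poly p z) > 0)"
  using assms(1,2)
proof (induction "degree p" arbitrary: p)
  case 0
  then obtain c where "p = [:c:]" by (metis degree_eq_zeroE)
  then show ?case by (simp add: pderiv_pCons)
next
  case (Suc d)
  then have "\<not> constant (poly p)" by (simp add: constant_degree)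
  then obtain a where a: "poly p a = 0" using fundamental_theorem_of_algebra by blast
  then obtain q where q: "p = [:- a, 1:] * q" by (metis poly_eq_0_iff_dvd dvdE)
  have q0: "q \<noteq> 0" using Suc.prems q by auto
  have "degree p = Suc (degree q)" using q0 unfolding q by (subst degree_mult_eq) auto
  then have d: "d = degree q" using Suc.hyps by simp
  have roots_q: "Im w = 0 \<and> Re w < 0" if "poly q w = 0" for w
    using Suc.prems(2)[of w] that unfolding q by simp
  define r where "r = - Re a"
  have r: "r > 0" "a = - complex_of_real r"
    using Suc.prems(2)[OF a] by (auto simp: r_def complex_eq_iff)
  have z: "z - a \<noteq> 0" "poly q z \<noteq> 0"
    using assms(3) roots_q[of z] r by (auto simp: complex_eq_iff)
  have "z * poly (pderiv p) z / poly p z = z / (z - a) + z * poly (pderiv q) z / poly q z"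
  proof -
    have "poly p z = (z - a) * poly q z" unfolding q by (simp add: algebra_simps)
    moreover have "poly (pderiv p) z = (z - a) * poly (pderiv q) z + poly q z"
      unfolding q pderiv_mult by (simp add: pderiv_pCons algebra_simps)
    ultimately show ?thesis using z by (simp add: divide_simps) (simp add: algebra_simps)
  qed
  moreover have "Im (z / (z - a)) > 0"
    using Im_divide_add_of_real[OF assms(3) r(1)] r(2) by simp
  ultimately show ?case
    using Suc.hyps(1)[OF d q0 roots_q] by simp
qed

section \<open>Location of the roots\<close>

lemma jacobi_poly_nonzero: "jacobi_poly m n \<noteq> 0"
proof
  assume "jacobi_poly m n = 0"
  then have "coeff (jacobi_poly m n) 0 = 0" by simp
  moreover have "(of_nat n :: complex) \<noteq> - 1" by (auto simp: complex_eq_iff)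
  ultimately show False by (simp add: add_eq_0_iff)
qed

lemma degree_jacobi_poly_pos:
  assumes "m > 0" "n > 0"
  shows "degree (jacobi_poly m n) > 0"
proof -
  have "coeff (jacobi_poly m n) 1 \<noteq> 0"
    using assms unfolding coeff_jacobi_poly of_nat_eq_0_iff by (simp add: binomial_eq_0_iff)
  then show ?thesis using le_degree by fastforce
qed

lemma poly_jacobi_poly:
  "poly (jacobi_poly m n) z = (\<Sum>k\<le>m. of_nat ((m choose k) * (Suc n choose Suc k)) * z ^ k)"
  by (simp add: jacobi_poly_def poly_sum poly_monom)

lemma poly_jacobi_poly_cnj: "poly (jacobi_poly m n) (cnj z) = cnj (poly (jacobi_poly m n) z)"
  by (simp add: poly_jacobi_poly)

lemma poly_jacobi_poly_nonneg_real:
  assumes "x \<ge> 0"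
  shows "poly (jacobi_poly m n) (of_real x) \<noteq> 0"
proof -
  let ?c = "\<lambda>k. real ((m choose k) * (Suc n choose Suc k))"
  have "(\<Sum>k\<le>m. ?c k * x ^ k) = ?c 0 + (\<Sum>k\<in>{..m} - {0}. ?c k * x ^ k)"
    by (subst sum.remove[where x = 0]) simp_all
  moreover have "(\<Sum>k\<in>{..m} - {0}. ?c k * x ^ k) \<ge> 0"
    using assms by (intro sum_nonneg) simp
  ultimately have "(\<Sum>k\<le>m. ?c k * x ^ k) > 0" by simp
  moreover have "poly (jacobi_poly m n) (of_real x) = of_real (\<Sum>k\<le>m. ?c k * x ^ k)"
    by (simp add: poly_jacobi_poly)
  ultimately show ?thesis by (metis less_irrefl of_real_eq_0_iff)
qed

text \<open>Induction on \<open>n\<close> along \<open>jacobi_poly_rec\<close> excludes the upper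
  half plane, conjugation the lower one, and the nonnegative coefficients with positive constant
  term exclude the nonnegative reals.\<close>

lemma jacobi_poly_root:
  assumes "poly (jacobi_poly m n) z = 0"
  shows "Im z = 0 \<and> Re z < 0"
  using assms
proof (induction n arbitrary: z)
  case 0
  have "jacobi_poly m 0 = 1"
    by (rule poly_eqI) (auto simp: coeff_1 binomial_eq_0)
  with 0 show ?case by simp
next
  case (Suc n)
  have upper: "poly (jacobi_poly m (Suc n)) w \<noteq> 0" if w: "Im w > 0" for w
  proof
    assume root: "poly (jacobi_poly m (Suc n)) w = 0"
    let ?h = "poly (jacobi_poly m n) w" and ?h' = "poly (pderiv (jacobi_poly m n)) w"
    have h: "?h \<noteq> 0" using Suc.IH[of w] w by auto
    have w1: "1 - w \<noteq> 0" using w by auto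
    have "(of_nat (n + 2) + of_nat m * w) * ?h + (1 - w) * (w * ?h') = 0"
      using arg_cong[OF jacobi_poly_rec[of n m], of "\<lambda>p. poly p w"] root
      by (simp add: algebra_simps)
    \<comment> \<open>Divide by \<open>(1 - w) * ?h\<close> and use (n + 2 + m w) / (1 - w) = (n +
      2) + (n + 2 + m) w / (1 - w). The second term has positive imaginary part and the third a
      nonnegative one.\<close>
    then have "of_nat (n + 2) + of_nat (n + 2 + m) * (w / (1 - w)) + w * ?h' / ?h = 0"
      using h w1 by (simp add: divide_simps) (simp add: algebra_simps)
    moreover have "Im (of_nat a + of_nat b * x + y) = real b * Im x + Im y" for a b x y
      by simp
    ultimately have "real (n + 2 + m) * Im (w / (1 - w)) + Im (w * ?h' / ?h) = 0"
      by (metis zero_complex.simps(2))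
    moreover have "Im (w / (1 - w)) > 0"
    proof -
      have "Im (w / (1 - w)) = Im w / ((1 - Re w)\<^sup>2 + (Im w)\<^sup>2)"
        by (simp add: Im_divide algebra_simps)
      moreover have "(1 - Re w)\<^sup>2 + (Im w)\<^sup>2 > 0" using w by (simp add: add_nonneg_pos)
      ultimately show ?thesis using w by simp
    qed
    then have "real (n + 2 + m) * Im (w / (1 - w)) > 0" by simp
    moreover have "Im (w * ?h' / ?h) \<ge> 0"
      using Im_log_derivative_ge[OF jacobi_poly_nonzero Suc.IH w] by blast
    ultimately show False by linarith
  qed
  have "Im z = 0"
    using upper[of z] upper[of "cnj z"] Suc.prems
    by (cases "Im z" "0 :: real" rule: linorder_cases) (auto simp: poly_jacobi_poly_cnj)
  moreover from this have "z = of_real (Re z)" by (simp add: complex_eq_iff)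
  then have "Re z < 0"
    using poly_jacobi_poly_nonneg_real[of "Re z" m "Suc n"] Suc.prems by force
  ultimately show ?case ..
qed

section \<open>Stability\<close>

text \<open>Combined with \<open>binom_gf_jacobi\<close> this identifies
  \<open>of_nat m * cross_snd m n t\<close> with t H'(t), where H is
  \<open>jacobi_poly m n\<close>.\<close>

lemma cross_snd_jacobi:
  assumes "m > 0"
  shows "of_nat m * cross_snd m n t + poly (jacobi_poly m n) t = of_nat (Suc n) * binom_gf m n t"
proof -
  \<comment> \<open>The coefficients are reindexed by the power of \<open>t\<close>, so that all
    three sums can be compared term by term.\<close>
  let ?a = "\<lambda>k. case k of 0 \<Rightarrow> 0 | Suc j \<Rightarrow> (m - 1 choose j) * (Suc n choose Suc k)"
  have A: "cross_snd m n t = (\<Sum>k\<le>m. of_nat (?a k) * t ^ k)"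
    unfolding cross_snd_def by (subst sum.atMost_shift) simp
  have coeff: "m * ?a k + (m choose k) * (Suc n choose Suc k)
      = Suc n * ((m choose k) * (n choose k))" for k
  proof (cases k)
    case (Suc j)
    have "m * (m - 1 choose j) = k * (m choose k)"
      using Suc by (simp only: binomial_absorption)
    moreover have "m * ?a k = m * (m - 1 choose j) * (Suc n choose Suc k)"
      using Suc by (simp del: binomial_Suc_Suc)
    ultimately have "m * ?a k + (m choose k) * (Suc n choose Suc k)
        = (m choose k) * (Suc k * (Suc n choose Suc k))"
      by (simp add: algebra_simps del: binomial_Suc_Suc)
    also have "\<dots> = (m choose k) * (Suc n * (n choose k))"
      by (simp only: Suc_times_binomial)
    finally show ?thesis by (simp only: mult.left_commute)
  qed simp
  have eq: "of_nat m * of_nat (?a k) * t ^ k + of_nat ((m choose k) * (Suc n choose Suc k)) * t ^ k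
      = of_nat (Suc n) * of_nat ((m choose k) * (n choose k)) * t ^ k" for k
    unfolding distrib_right[symmetric] of_nat_mult[symmetric] of_nat_add[symmetric] coeff ..
  show ?thesis
    unfolding A poly_jacobi_poly binom_gf_def sum_distrib_left mult.assoc[symmetric]
      sum.distrib[symmetric] eq ..
qed

text \<open>Likewise, with H = \<open>jacobi_poly m n\<close>, this amounts to n (n + 1)
  \<open>cross_fst m n t\<close> = (m + 1) t H'(t). Thus both correction factors are multiples of
  the same function.\<close>

lemma cross_fst_jacobi:
  assumes "n > 0"
  shows "of_nat (n * Suc n) * cross_fst m n t + of_nat (Suc m) * poly (jacobi_poly m n) t
    = of_nat (Suc m * Suc n) * binom_gf m n t"
proof -
  let ?b = "\<lambda>k. case k of 0 \<Rightarrow> 0 | Suc j \<Rightarrow> (Suc m choose Suc k) * (n - 1 choose j)"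
  have B: "cross_fst m n t = (\<Sum>k\<le>m. of_nat (?b k) * t ^ k)"
    unfolding cross_fst_def by (subst sum.atMost_shift) simp
  have coeff: "n * Suc n * ?b k + Suc m * ((m choose k) * (Suc n choose Suc k))
      = Suc m * Suc n * ((m choose k) * (n choose k))" for k
  proof (cases k)
    case (Suc j)
    have "n * (n - 1 choose j) = k * (n choose k)"
      using Suc by (simp only: binomial_absorption)
    then have "n * Suc n * ?b k = k * (Suc n * (n choose k)) * (Suc m choose Suc k)"
      using Suc by (simp add: algebra_simps del: binomial_Suc_Suc mult_Suc mult_Suc_right)
    also have "\<dots> = k * (Suc n choose Suc k) * (Suc k * (Suc m choose Suc k))"
      by (simp only: Suc_times_binomial[symmetric] mult.assoc mult.commute mult.left_commute)
    also have "\<dots> = k * (Suc n choose Suc k) * (Suc m * (m choose k))"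
      by (simp only: Suc_times_binomial)
    finally have "n * Suc n * ?b k + Suc m * ((m choose k) * (Suc n choose Suc k))
        = Suc m * ((m choose k) * (Suc k * (Suc n choose Suc k)))"
      by (simp add: algebra_simps del: binomial_Suc_Suc)
    also have "\<dots> = Suc m * ((m choose k) * (Suc n * (n choose k)))"
      by (simp only: Suc_times_binomial)
    finally show ?thesis by (simp only: mult.left_commute mult.assoc)
  qed simp
  have eq: "of_nat (n * Suc n) * of_nat (?b k) * t ^ k
      + of_nat (Suc m) * of_nat ((m choose k) * (Suc n choose Suc k)) * t ^ k
      = of_nat (Suc m * Suc n) * of_nat ((m choose k) * (n choose k)) * t ^ k" for k
    unfolding distrib_right[symmetric] of_nat_mult[symmetric] of_nat_add[symmetric] coeff ..
  show ?thesis
    unfolding B poly_jacobi_poly binom_gf_def sum_distrib_left mult.assoc[symmetric]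
      sum.distrib[symmetric] eq ..
qed

text \<open>The right side is the derivative of t H(t), with H = \<open>jacobi_poly m n\<close>; the
  factor \<open>k + 1\<close> it produces is absorbed by \<open>Suc n choose Suc k\<close>.\<close>

lemma binom_gf_jacobi:
  "of_nat (Suc n) * binom_gf m n t = poly (jacobi_poly m n) t
      + t * poly (pderiv (jacobi_poly m n)) t"
proof -
  have deriv: "t * poly (pderiv (jacobi_poly m n)) t =
      (\<Sum>k\<le>m. of_nat (k * (m choose k) * (Suc n choose Suc k)) * t ^ k)"
    \<comment> \<open>At order one \<open>higher_pderiv_sum\<close> says that differentiation
      commutes with finite sums.\<close>
    unfolding jacobi_poly_def higher_pderiv_sum[of 1, simplified] poly_sum sum_distrib_left
  proof (intro sum.cong refl)
    show "t * poly (pderiv (monom (of_nat ((m choose k) * (Suc n choose Suc k))) k)) t =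
      of_nat (k * (m choose k) * (Suc n choose Suc k)) * t ^ k" for k
      by (cases k) (simp_all add: pderiv_monom poly_monom algebra_simps del: binomial_Suc_Suc)
  qed
  have coeff: "(m choose k) * (Suc n choose Suc k) + k * (m choose k) * (Suc n choose Suc k) =
      Suc n * ((m choose k) * (n choose k))" for k
  proof -
    have "(m choose k) * (Suc n choose Suc k) + k * (m choose k) * (Suc n choose Suc k) =
        (m choose k) * (Suc k * (Suc n choose Suc k))"
      by (simp add: algebra_simps del: binomial_Suc_Suc)
    then show ?thesis unfolding Suc_times_binomial by (simp only: mult.left_commute)
  qed
  have eq: "of_nat ((m choose k) * (Suc n choose Suc k)) * t ^ k
      + of_nat (k * (m choose k) * (Suc n choose Suc k)) * t ^ k =
      of_nat (Suc n) * of_nat ((m choose k) * (n choose k)) * t ^ k" for k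
    using arg_cong[OF coeff[of k], of "\<lambda>j. of_nat j * t ^ k"]
    by (simp only: of_nat_add of_nat_mult distrib_right)
  show ?thesis
    unfolding deriv poly_jacobi_poly binom_gf_def sum_distrib_left mult.assoc[symmetric]
      sum.distrib[symmetric] eq ..
qed

text \<open>Inversion exchanges the two half planes, so b = c / a would have nonnegative imaginary
  part.\<close>

lemma mult_lower_half_plane_neq:
  assumes "Im a < 0" "Im b < 0" "c \<ge> 0"
  shows "a * b \<noteq> complex_of_real c"
proof
  assume "a * b = complex_of_real c"
  moreover have "a \<noteq> 0" using assms(1) by auto
  ultimately have "b = complex_of_real c / a" by (metis nonzero_mult_div_cancel_left)
  then have "Im b = - (c * Im a) / ((Re a)\<^sup>2 + (Im a)\<^sup>2)" by (simp add: Im_divide)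
  moreover have "- (c * Im a) / ((Re a)\<^sup>2 + (Im a)\<^sup>2) \<ge> 0"
    using assms by (intro divide_nonneg_nonneg) (simp_all add: mult_nonneg_nonpos)
  ultimately show False using assms(2) by simp
qed

lemma chain_gf_nonzero:
  assumes "m > 0" "n > 0" "Im u > 0" "Im v > 0"
  shows "chain_gf m m n n u v \<noteq> 0"
proof
  assume zero: "chain_gf m m n n u v = 0"
  let ?h = "\<lambda>t. poly (jacobi_poly m n) t"
  define w where "w = (\<lambda>t. t * poly (pderiv (jacobi_poly m n)) t / ?h t)"
  have h: "?h t \<noteq> 0" if "Im t > 0" for t using jacobi_poly_root[of m n t] that by auto
  have w: "Im (w t) > 0" if "Im t > 0" for t
  proof -
    have "degree (jacobi_poly m n) > 0 \<longrightarrow> Im (w t) > 0"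
      unfolding w_def
      by (rule conjunct2[OF Im_log_derivative_ge[OF jacobi_poly_nonzero _ that]])
          (rule jacobi_poly_root)
    then show ?thesis using degree_jacobi_poly_pos[OF assms(1,2)] by blast
  qed
  have G: "of_nat (Suc n) * binom_gf m n t = ?h t * (1 + w t)" if "Im t > 0" for t
    using h[OF that] by (simp add: binom_gf_jacobi w_def field_simps del: of_nat_Suc)
  have "of_nat m * cross_snd m n v + ?h v = ?h v * (1 + w v)"
    unfolding G[OF assms(4), symmetric] by (rule cross_snd_jacobi[OF assms(1)])
  then have A: "of_nat m * cross_snd m n v = ?h v * w v" by (simp add: distrib_left)
  have "of_nat (n * Suc n) * cross_fst m n u + of_nat (Suc m) * ?h u
      = of_nat (Suc m) * (?h u * (1 + w u))"
    unfolding G[OF assms(3), symmetric] cross_fst_jacobi[OF assms(2)]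
    by (simp only: of_nat_mult mult.assoc)
  then have B: "of_nat (n * Suc n) * cross_fst m n u = of_nat (Suc m) * (?h u * w u)"
    by (simp only: distrib_left mult_1_right add.commute[of _ "of_nat (Suc m) * ?h u"]
        add_left_cancel)
  \<comment> \<open>The multiplier n m (n + 1)^2 clears all denominators when the vanishing closed
    form is rewritten by \<open>G\<close>, \<open>A\<close> and \<open>B\<close>.\<close>
  have "of_nat (n * m) * ((of_nat (Suc n) * binom_gf m n u) * (of_nat (Suc n) * binom_gf m n v))
      = of_nat (n * m) * of_nat (Suc n) * of_nat (Suc n) * (binom_gf m n u * binom_gf m n v)"
    by (simp only: mult.assoc mult.left_commute)
  also have "binom_gf m n u * binom_gf m n v = cross_fst m n u * cross_snd m n v"
    using zero chain_gf_eq[of n n m u v] by simp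
  also have "of_nat (n * m) * of_nat (Suc n) * of_nat (Suc n) * (cross_fst m n u * cross_snd m n v)
      = of_nat (Suc n) * ((of_nat (n * Suc n) * cross_fst m n u) * (of_nat m * cross_snd m n v))"
    by (simp only: of_nat_mult mult.assoc mult.left_commute mult.commute)
  finally have "of_nat (n * m) * ((?h u * (1 + w u)) * (?h v * (1 + w v)))
      = of_nat (Suc n) * (of_nat (Suc m) * (?h u * w u) * (?h v * w v))"
    unfolding G[OF assms(3)] G[OF assms(4)] A B .
  then have "(?h u * ?h v) * (of_nat (n * m) * ((1 + w u) * (1 + w v)))
      = (?h u * ?h v) * (of_nat (Suc n * Suc m) * (w u * w v))"
    by (simp only: of_nat_mult mult.assoc mult.left_commute mult.commute)
  moreover have "?h u * ?h v \<noteq> 0" using h assms(3,4) by simp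
  ultimately have eq: "of_nat (n * m) * ((1 + w u) * (1 + w v))
      = of_nat (Suc n * Suc m) * (w u * w v)"
    using mult_left_cancel by blast
  have w0: "w u \<noteq> 0" "w v \<noteq> 0" using w[OF assms(3)] w[OF assms(4)] by auto
  have nm: "(of_nat (n * m) :: complex) \<noteq> 0" using assms by simp
  have "(1 + 1 / w u) * (1 + 1 / w v) = ((1 + w u) * (1 + w v)) / (w u * w v)"
    using w0 by (simp add: field_simps)
  also have "\<dots> = of_nat (Suc n * Suc m) / of_nat (n * m)"
  proof (rule frac_eq_eq[THEN iffD2, OF _ nm])
    show "w u * w v \<noteq> 0" using w0 by simp
    show "(1 + w u) * (1 + w v) * of_nat (n * m) = of_nat (Suc n * Suc m) * (w u * w v)"
      by (subst mult.commute) (rule eq)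
  qed
  also have "\<dots> = complex_of_real (real (Suc n * Suc m) / real (n * m))"
    by (simp del: of_nat_mult of_nat_Suc)
  finally have "(1 + 1 / w u) * (1 + 1 / w v)
      = complex_of_real (real (Suc n * Suc m) / real (n * m))" .
  moreover have "Im (1 + 1 / w t) < 0" if "Im t > 0" for t
  proof -
    have "Im (1 + 1 / w t) = - Im (w t) / ((Re (w t))\<^sup>2 + (Im (w t))\<^sup>2)" by (simp add: Im_divide)
    moreover have "(Re (w t))\<^sup>2 + (Im (w t))\<^sup>2 > 0" using w[OF that] by (simp add: add_nonneg_pos)
    ultimately show ?thesis using w[OF that] by simp
  qed
  moreover have "real (Suc n * Suc m) / real (n * m) \<ge> 0" by (rule divide_nonneg_nonneg) simp_all
  ultimately show False using mult_lower_half_plane_neq assms(3,4) by blast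
qed

section \<open>Evaluation of the layer-refined polynomial\<close>

text \<open>Exponents outside the support contribute zero. A common index set is needed for
  additivity, since cancellation may shrink the support of a sum.\<close>

lemma eval_complex_superset:
  assumes "finite S" "Poly_Mapping.keys p \<subseteq> S"
  shows "eval_complex p z = (\<Sum>e\<in>S. of_real (Poly_Mapping.lookup p e) *
      (\<Prod>x\<in>Poly_Mapping.keys e. z x ^ Poly_Mapping.lookup e x))"
  unfolding eval_complex_def using assms
  by (intro sum.mono_neutral_left) (auto simp: in_keys_iff)

lemma eval_complex_add: "eval_complex (p + q) z = eval_complex p z + eval_complex q z"
proof -
  let ?S = "Poly_Mapping.keys p \<union> Poly_Mapping.keys q"
  have "Poly_Mapping.keys (p + q) \<subseteq> ?S" by (rule keys_add)
  then show ?thesis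
    by (simp add: eval_complex_superset[of ?S] lookup_add sum.distrib[symmetric] distrib_right)
qed

lemma eval_complex_sum: "eval_complex (\<Sum>a\<in>S. f a) z = (\<Sum>a\<in>S. eval_complex (f a) z)"
proof (induction S rule: infinite_finite_induct)
  case (insert a S)
  then show ?case by (simp add: eval_complex_add)
qed (simp_all add: eval_complex_def)

lemma eval_complex_monomial:
  "eval_complex (Poly_Mapping.single
      (Poly_Mapping.single Var_u a + Poly_Mapping.single Var_v b) 1) z = z Var_u ^ a * z Var_v ^ b"
proof -
  let ?e = "Poly_Mapping.single Var_u a + Poly_Mapping.single Var_v b"
  \<comment> \<open>A variable with exponent zero is missing from the keys, but its factor is
    1.\<close>
  have "(\<Prod>x\<in>Poly_Mapping.keys ?e. z x ^ Poly_Mapping.lookup ?e x) =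
      (\<Prod>x\<in>{Var_u, Var_v}. z x ^ Poly_Mapping.lookup ?e x)"
    by (rule prod.mono_neutral_left)
      (auto simp: in_keys_iff intro: layer_var.exhaust)
  then show ?thesis by (simp add: eval_complex_def lookup_add lookup_single)
qed

theorem theorem3p21:
  fixes m n :: nat
  assumes "m > 0" and "n > 0"
  shows "real_stable (layer_antichain_poly m n)"
  unfolding real_stable_def
proof (intro allI impI)
  fix z :: "layer_var \<Rightarrow> complex"
  assume z: "\<forall>x. Im (z x) > 0"
  have "eval_complex (layer_antichain_poly m n) z = chain_gf m m n n (z Var_v) (z Var_u)"
    unfolding layer_antichain_poly_def eval_complex_sum eval_complex_monomial
    by (rule sum_antichains_eq_chain_gf)
  then show "eval_complex (layer_antichain_poly m n) z \<noteq> 0"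
    using chain_gf_nonzero[OF assms] z by simp
qed

end
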